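(* In the polynomial ring $\mathbb C[x,y,z,t,u]$ set $a=1+xy+2zu$, $c=zy-2au$, $m=zy+2au$ and $\widetilde P=x^2y+2xzu+z^2+x+t^3$, and let $\mathcal Y=V(\widetilde P)\subset\mathbb A^5_{\mathbb C}$. Consider the $\mathbb C$-derivation $E$ of $\mathbb C[x,y,z,t,u]$ defined by $$E(x)=3t^2m,\quad E(y)=0,\quad E(z)=-3ayt^2,\quad E(t)=ac,\quad E(u)=-\tfrac32y^2t^2 .$$ Then $E(a)=E(c)=0$ and $E(m)=-6ay^2t^2$. Moreover, $E$ is locally nilpotent and annihilates $\widetilde P$, i.e. $E(\widetilde P)=0$. It therefore induces a locally nilpotent derivation of the coordinate ring $\mathbb C[\mathcal Y]=\mathbb C[x,y,z,t,u]/(\widetilde P)$.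
   Context: A derivation $\partial$ of a $\mathbb C$-algebra $A$ is locally nilpotent if for every $f\in A$ there is $n\ge 1$ with $\partial^n(f)=0$. *)

theory Defs
  imports Complex_Main "HOL-Library.Poly_Mapping"
begin

locale complex_algebra = vector_space scale
  for scale :: "complex \<Rightarrow> 'a::comm_ring_1 \<Rightarrow> 'a" +
  assumes scale_mult_left: "scale k f * g = scale k (f * g)"

locale complex_derivation = complex_algebra scale + Vector_Spaces.linear scale scale D
  for scale :: "complex \<Rightarrow> 'a::comm_ring_1 \<Rightarrow> 'a" and D :: "'a \<Rightarrow> 'a" +
  assumes leibniz: "D (f * g) = f * D g + g * D f"

definition locally_nilpotent :: "('a::zero \<Rightarrow> 'a) \<Rightarrow> bool" where
  "locally_nilpotent D \<longleftrightarrow> (\<forall>f. \<exists>n\<ge>1. (D ^^ n) f = 0)"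


text \<open>The polynomial ring \<open>\<complex>[x,y,z,t,u]\<close>: finitely supported functions from exponent vectors
  to \<open>\<complex>\<close>, multiplied by convolution.\<close>

datatype var = VX | VY | VZ | VT | VU

type_synonym poly5 = "(var \<Rightarrow>\<^sub>0 nat) \<Rightarrow>\<^sub>0 complex"

definition indet :: "var \<Rightarrow> poly5" where
  "indet v = Poly_Mapping.single (Poly_Mapping.single v 1) 1"

definition scaleP :: "complex \<Rightarrow> poly5 \<Rightarrow> poly5" where
  "scaleP k f = Poly_Mapping.map ((*) k) f"

abbreviation pX :: poly5 where "pX \<equiv> indet VX"
abbreviation pY :: poly5 where "pY \<equiv> indet VY"
abbreviation pZ :: poly5 where "pZ \<equiv> indet VZ"
abbreviation pT :: poly5 where "pT \<equiv> indet VT"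
abbreviation pU :: poly5 where "pU \<equiv> indet VU"

definition pa :: poly5 where "pa = 1 + pX * pY + 2 * pZ * pU"
definition pc :: poly5 where "pc = pZ * pY - 2 * pa * pU"
definition pm :: poly5 where "pm = pZ * pY + 2 * pa * pU"
definition Ptilde :: poly5 where
  "Ptilde = pX ^ 2 * pY + 2 * pX * pZ * pU + pZ ^ 2 + pX + pT ^ 3"

lemma scaleP_conv_mult: "scaleP k f = Poly_Mapping.single 0 k * f"
  by (simp add: scaleP_def mult_map_scale_conv_mult)

lemma scaleP_add_left: "scaleP (k + l) f = scaleP k f + scaleP l f"
  and scaleP_add_right: "scaleP k (f + g) = scaleP k f + scaleP k g"
  and scaleP_scaleP: "scaleP k (scaleP l f) = scaleP (k * l) f"
  and scaleP_one: "scaleP 1 f = f"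
  and scaleP_mult_left: "scaleP k f * g = scaleP k (f * g)"
proof -
  show "scaleP (k + l) f = scaleP k f + scaleP l f"
    by (simp only: scaleP_conv_mult single_add ring_distribs)
  show "scaleP k (f + g) = scaleP k f + scaleP k g"
    by (simp only: scaleP_conv_mult ring_distribs)
  have "Poly_Mapping.single (0 :: var \<Rightarrow>\<^sub>0 nat) k * Poly_Mapping.single 0 l
      = Poly_Mapping.single 0 (k * l)"
    by (simp only: mult_single add_0)
  then show "scaleP k (scaleP l f) = scaleP (k * l) f"
    by (simp only: scaleP_conv_mult flip: mult.assoc)
  show "scaleP 1 f = f"
    by (simp only: scaleP_conv_mult single_one mult_1)
  show "scaleP k f * g = scaleP k (f * g)"
    by (simp only: scaleP_conv_mult mult.assoc)
qed

lemmas scaleP_simps = scaleP_add_left scaleP_add_right scaleP_scaleP scaleP_one scaleP_mult_left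

lemma complex_algebra_scaleP: "complex_algebra scaleP"
  by unfold_locales (simp_all only: scaleP_simps)


text \<open>The coordinate ring \<open>\<complex>[x,y,z,t,u] / (Ptilde)\<close>: residue classes modulo the principal ideal
  generated by \<open>Ptilde\<close>.\<close>

lemma dvd_diff_mult:
  fixes p :: "'a::comm_ring_1"
  assumes "p dvd a - b" "p dvd c - d"
  shows "p dvd a * c - b * d"
proof -
  have "a * c - b * d = (a - b) * c + b * (c - d)" by (simp add: algebra_simps)
  then show ?thesis using assms by simp
qed

text \<open>Lifting and transfer should stop at \<open>poly5\<close> and not unfold it to bare functions.\<close>

lifting_forget poly_mapping.lifting

quotient_type coord_ring = poly5 / "\<lambda>f g. Ptilde dvd f - g"
proof (rule equivpI)
  show "reflp (\<lambda>f g. Ptilde dvd f - g)" by (simp add: reflp_def)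
  show "symp (\<lambda>f g. Ptilde dvd f - g)" by (metis sympI dvd_minus_iff minus_diff_eq)
  show "transp (\<lambda>f g. Ptilde dvd f - g)"
  proof (rule transpI)
    fix f g h assume "Ptilde dvd f - g" "Ptilde dvd g - h"
    then have "Ptilde dvd (f - g) + (g - h)" by (rule dvd_add)
    then show "Ptilde dvd f - h" by simp
  qed
qed

lift_definition residue :: "poly5 \<Rightarrow> coord_ring" is "\<lambda>f. f" .

lemma lookup_mult_0:
  fixes f g :: poly5
  shows "poly_mapping.lookup (f * g) 0 = poly_mapping.lookup f 0 * poly_mapping.lookup g 0"
proof -
  have *: "0 = l + q \<longleftrightarrow> l = 0 \<and> q = 0" for l q :: "var \<Rightarrow>\<^sub>0 nat"
    by (auto simp: poly_mapping_eq_iff plus_poly_mapping.rep_eq fun_eq_iff)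
  have "poly_mapping.lookup (f * g) 0
      = (\<Sum>l. (poly_mapping.lookup f l * poly_mapping.lookup g 0) when l = 0)"
    unfolding lookup_mult
    by (rule Sum_any.cong) (auto simp: * when_def)
  then show ?thesis by simp
qed

lemma lookup_indet_0: "poly_mapping.lookup (indet v) 0 = 0"
  by (simp add: indet_def lookup_single when_def poly_mapping_eq_iff fun_eq_iff)

lemma Ptilde_not_dvd_one: "\<not> Ptilde dvd 1"
proof
  assume "Ptilde dvd 1"
  then obtain g where "1 = Ptilde * g" ..
  then have "poly_mapping.lookup (1 :: poly5) 0 = poly_mapping.lookup Ptilde 0 * poly_mapping.lookup g 0"
    by (metis lookup_mult_0)
  moreover have "poly_mapping.lookup Ptilde 0 = 0"
    by (simp add: Ptilde_def lookup_add lookup_mult_0 lookup_indet_0 power2_eq_square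
        power3_eq_cube)
  ultimately show False by (simp add: lookup_one)
qed

instantiation coord_ring :: comm_ring_1
begin

lift_definition zero_coord_ring :: coord_ring is 0 .
lift_definition one_coord_ring :: coord_ring is 1 .
lift_definition plus_coord_ring :: "coord_ring \<Rightarrow> coord_ring \<Rightarrow> coord_ring" is "(+)"
  by (metis add_diff_add dvd_add)
lift_definition minus_coord_ring :: "coord_ring \<Rightarrow> coord_ring \<Rightarrow> coord_ring" is "(-)"
proof -
  fix a b c d :: poly5 assume "Ptilde dvd a - b" "Ptilde dvd c - d"
  then have "Ptilde dvd (a - b) - (c - d)" by (rule dvd_diff)
  then show "Ptilde dvd (a - c) - (b - d)" by (simp add: algebra_simps)
qed
lift_definition uminus_coord_ring :: "coord_ring \<Rightarrow> coord_ring" is uminus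
  by (metis dvd_minus_iff minus_diff_minus)
lift_definition times_coord_ring :: "coord_ring \<Rightarrow> coord_ring \<Rightarrow> coord_ring" is "(*)"
  by (rule dvd_diff_mult)

instance
  by intro_classes (transfer; simp add: algebra_simps Ptilde_not_dvd_one)+

end

lift_definition scaleY :: "complex \<Rightarrow> coord_ring \<Rightarrow> coord_ring" is scaleP
  by (simp add: scaleP_conv_mult dvd_diff_mult)

lemma complex_algebra_scaleY: "complex_algebra scaleY"
  by unfold_locales
    (transfer; simp add: scaleP_simps)+

lemma residue_eq_0_iff: "residue f = 0 \<longleftrightarrow> Ptilde dvd f"
  by transfer simp


definition is_E :: "(poly5 \<Rightarrow> poly5) \<Rightarrow> bool" where
  "is_E E \<longleftrightarrow> complex_derivation scaleP E
    \<and> E pX = 3 * pT ^ 2 * pm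
    \<and> E pY = 0
    \<and> E pZ = - 3 * pa * pY * pT ^ 2
    \<and> E pT = pa * pc
    \<and> E pU = scaleP (- 3 / 2) (pY ^ 2 * pT ^ 2)"

end

theory Submission
  imports Defs
begin

text \<open>
  A derivation of a polynomial ring is determined by its values on the indeterminates, and these
  values can be prescribed at will: \<open>\<Sum>v. d v * \<partial>/\<partial>v\<close> is the derivation that sends each \<open>v\<close> to
  \<open>d v\<close> (\<open>derivation_eqI\<close>, \<open>complex_derivation_with_values\<close>, \<open>derivation_with_values_indet\<close>).
  So \<open>E\<close> exists and is unique.

  The Leibniz rule gives \<open>E a = 3yt^2 (m - zy - 2au)\<close>, which is zero by the choice of \<open>m\<close>. With
  \<open>E a = 0\<close>, only \<open>y E z\<close> and \<open>2a E u\<close> contribute to \<open>E c\<close> and \<open>E m\<close>; both are \<open>-3ay^2t^2\<close>, so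
  they cancel in \<open>c\<close> and add up in \<open>m\<close>. Finally,
  \<open>E Ptilde = 3t^2 (a (m + c - 2zy) + xy (m - zy - 2au)) = 0\<close>.

  For local nilpotence, one does not bound \<open>E^n f\<close> for a general \<open>f\<close>. The elements killed by
  some power of a derivation form a subalgebra (\<open>nil_add\<close>, \<open>nil_mult\<close>), and an element belongs to
  it as soon as its derivative does (\<open>nil_if_derivative_nil\<close>). Hence only the five indeterminates
  matter, and they are reached one after the other: \<open>y\<close>, \<open>a\<close>, \<open>c\<close> are in the kernel;
  \<open>E t = ac\<close> gives \<open>t\<close>; \<open>E z\<close>, \<open>E u\<close> and \<open>E m\<close> are polynomials in \<open>a\<close>, \<open>y\<close>, \<open>t\<close>; and
  \<open>E x = 3t^2 m\<close> finally gives \<open>x\<close>.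

  Since \<open>E Ptilde = 0\<close>, the ideal of \<open>Ptilde\<close> is stable under \<open>E\<close>, so \<open>E\<close> acts on residue
  classes; the Leibniz rule and nilpotence pass to the quotient because the residue map is a
  surjective homomorphism (\<open>induced_derivation\<close>).
\<close>

section \<open>Derivations and their nilpotent elements\<close>

context complex_derivation
begin

lemma derivation_add: "D (f + g) = D f + D g"
  and derivation_diff: "D (f - g) = D f - D g"
  and derivation_minus: "D (- f) = - D f"
  and derivation_zero: "D 0 = 0"
  and derivation_scale: "D (scale k f) = scale k (D f)"
  by (rule add diff neg zero scale)+

lemma derivation_one: "D 1 = 0"
  using leibniz[of 1 1] by simp

lemma derivation_of_nat: "D (of_nat n) = 0"
  by (induction n) (simp_all add: derivation_zero derivation_one derivation_add)

lemma derivation_numeral: "D (numeral n) = 0"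
  using derivation_of_nat[of "numeral n"] by simp

lemma derivation_square: "D (f ^ 2) = 2 * f * D f"
  by (simp add: power2_eq_square leibniz algebra_simps)

lemma derivation_cube: "D (f ^ 3) = 3 * f ^ 2 * D f"
  by (simp add: power3_eq_cube power2_eq_square leibniz algebra_simps)

lemmas derivation_simps =
  derivation_add derivation_diff derivation_minus derivation_zero derivation_scale
  derivation_one derivation_numeral leibniz derivation_square derivation_cube

lemma iterate_add: "(D ^^ n) (f + g) = (D ^^ n) f + (D ^^ n) g"
  by (induction n) (simp_all add: derivation_add)

lemma iterate_zero: "(D ^^ n) 0 = 0"
  by (induction n) (simp_all add: derivation_zero)

lemma iterate_eq_0_mono:
  assumes "(D ^^ m) f = 0" "m \<le> n"
  shows "(D ^^ n) f = 0"
proof -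
  have "(D ^^ n) f = (D ^^ (n - m)) ((D ^^ m) f)"
    using assms(2) by (metis comp_apply funpow_add le_add_diff_inverse2)
  then show ?thesis by (simp add: assms(1) iterate_zero)
qed

text \<open>Expanding \<open>D^(m + n) (f g)\<close> by the iterated Leibniz rule, every term contains at least \<open>m\<close>
  derivatives of \<open>f\<close> or at least \<open>n\<close> of \<open>g\<close>. The induction on \<open>m + n\<close> peels off one \<open>D\<close> at a
  time and so avoids binomial coefficients.\<close>

lemma iterate_mult_eq_0:
  assumes "(D ^^ m) f = 0" "(D ^^ n) g = 0"
  shows "(D ^^ (m + n)) (f * g) = 0"
  using assms
proof (induction "m + n" arbitrary: m n f g)
  case 0
  then show ?case by simp
next
  case (Suc k)
  show ?case
  proof (cases "m = 0 \<or> n = 0")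
    case True
    with Suc.prems have "f * g = 0" by auto
    then show ?thesis by (simp add: iterate_zero)
  next
    case False
    then obtain m' n' where mn: "m = Suc m'" "n = Suc n'"
      by (meson not0_implies_Suc)
    have "(D ^^ (m + n')) (f * D g) = 0"
      by (rule Suc.hyps(1)) (use Suc.hyps(2) Suc.prems mn in \<open>simp_all add: funpow_swap1\<close>)
    moreover have "(D ^^ (n + m')) (g * D f) = 0"
      by (rule Suc.hyps(1)) (use Suc.hyps(2) Suc.prems mn in \<open>simp_all add: funpow_swap1\<close>)
    moreover have "m + n' = k" "n + m' = k"
      using Suc.hyps(2) mn by simp_all
    ultimately have "(D ^^ k) (D (f * g)) = 0"
      by (simp add: leibniz iterate_add)
    then show ?thesis
      by (simp flip: Suc.hyps(2) add: funpow_swap1)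
  qed
qed

definition nil :: "'a set" where
  "nil = {f. \<exists>n. (D ^^ n) f = 0}"

lemma nilI: "(D ^^ n) f = 0 \<Longrightarrow> f \<in> nil"
  by (auto simp: nil_def)

lemma nil_add: "f \<in> nil \<Longrightarrow> g \<in> nil \<Longrightarrow> f + g \<in> nil"
proof -
  assume "f \<in> nil" "g \<in> nil"
  then obtain m n where "(D ^^ m) f = 0" "(D ^^ n) g = 0" by (auto simp: nil_def)
  then have "(D ^^ (max m n)) (f + g) = 0"
    by (simp add: iterate_add iterate_eq_0_mono[of m f] iterate_eq_0_mono[of n g])
  then show "f + g \<in> nil" by (rule nilI)
qed

lemma nil_mult: "f \<in> nil \<Longrightarrow> g \<in> nil \<Longrightarrow> f * g \<in> nil"
  unfolding nil_def using iterate_mult_eq_0 by blast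

lemma nil_power: "f \<in> nil \<Longrightarrow> f ^ n \<in> nil"
  by (induction n) (auto intro: nil_mult nilI[of 1] simp: derivation_one)

lemma nil_constant: "D f = 0 \<Longrightarrow> f \<in> nil"
  by (rule nilI[of 1]) simp

lemma nil_minus: "f \<in> nil \<Longrightarrow> - f \<in> nil"
  using nil_mult[of "- 1" f] by (simp add: nil_constant derivation_simps)

text \<open>This is what lets membership spread along a triangular derivation: each generator has a
  derivative built from generators treated before it.\<close>

lemma nil_if_derivative_nil: "D f \<in> nil \<Longrightarrow> f \<in> nil"
proof -
  assume "D f \<in> nil"
  then obtain n where "(D ^^ n) (D f) = 0" by (auto simp: nil_def)
  then have "(D ^^ Suc n) f = 0" by (simp add: funpow_swap1)
  then show "f \<in> nil" by (rule nilI)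
qed

lemma locally_nilpotent_if_nil_UNIV:
  assumes "\<And>f. f \<in> nil"
  shows "locally_nilpotent D"
  unfolding locally_nilpotent_def
proof
  fix f
  obtain n where "(D ^^ n) f = 0" using assms by (auto simp: nil_def)
  then have "(D ^^ Suc n) f = 0" by (rule iterate_eq_0_mono) simp
  then show "\<exists>n\<ge>1. (D ^^ n) f = 0" by (metis le_add1 plus_1_eq_Suc)
qed

end

section \<open>Derivations of polynomial rings\<close>

lemma polynomial_additive_induct [case_names monomial add]:
  fixes f :: "'m \<Rightarrow>\<^sub>0 'k::comm_monoid_add"
  assumes "\<And>\<alpha> c. P (Poly_Mapping.single \<alpha> c)"
    and "\<And>f g. P f \<Longrightarrow> P g \<Longrightarrow> P (f + g)"
  shows "P f"
proof -
  have "P 0" using assms(1)[of _ 0] by simp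
  then show ?thesis
  proof (induction f rule: update_induct)
    case (update f \<alpha> c)
    then have "Poly_Mapping.update \<alpha> c f = Poly_Mapping.single \<alpha> c + f"
      by (intro poly_mapping_eqI)
        (auto simp: lookup_update lookup_add lookup_single when_def in_keys_iff)
    with update assms show ?case by simp
  qed
qed

text \<open>A polynomial is a sum of monomials, and a monomial is a constant times a product of
  indeterminates. Exponent vectors are themselves finitely supported functions, so the additive
  induction applies to them as well and breaks \<open>\<alpha>\<close> into multiples of unit vectors.\<close>

lemma polynomial_generator_induct [case_names const indet add mult]:
  fixes f :: "('v \<Rightarrow>\<^sub>0 nat) \<Rightarrow>\<^sub>0 'k::comm_semiring_1"
  assumes const: "\<And>c. P (Poly_Mapping.single 0 c)"
    and indet: "\<And>v. P (Poly_Mapping.single (Poly_Mapping.single v 1) 1)"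
    and add: "\<And>f g. P f \<Longrightarrow> P g \<Longrightarrow> P (f + g)"
    and mult: "\<And>f g. P f \<Longrightarrow> P g \<Longrightarrow> P (f * g)"
  shows "P f"
proof (induction f rule: polynomial_additive_induct)
  case (monomial \<alpha> c)
  have "P (Poly_Mapping.single \<alpha> 1)"
  proof (induction \<alpha> rule: polynomial_additive_induct)
    case (monomial v n)
    show ?case
    proof (induction n)
      case 0
      show ?case using const[of 1] by simp
    next
      case (Suc n)
      from mult[OF indet[of v] Suc.IH] show ?case
        by (simp add: mult_single flip: single_add)
    qed
  next
    case (add \<alpha> \<beta>)
    from mult[OF add] show ?case by (simp add: mult_single)
  qed
  from mult[OF const[of c] this] show ?case by (simp add: mult_single)
qed (rule add)

text \<open>The truncated subtraction of the unit vector is harmless: it only goes wrong for exponents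
  with \<open>\<alpha> v = 0\<close>, where the coefficient vanishes.\<close>

definition partial :: "'v \<Rightarrow> (('v \<Rightarrow>\<^sub>0 nat) \<Rightarrow>\<^sub>0 'k::comm_semiring_1) \<Rightarrow> (('v \<Rightarrow>\<^sub>0 nat) \<Rightarrow>\<^sub>0 'k)"
  where "partial v f =
    (\<Sum>\<alpha>. Poly_Mapping.single (\<alpha> - Poly_Mapping.single v 1)
      (of_nat (poly_mapping.lookup \<alpha> v) * poly_mapping.lookup f \<alpha>))"

lemma partial_add: "partial v (f + g) = partial v f + partial v g"
proof -
  have fin: "finite {\<alpha>. Poly_Mapping.single (\<alpha> - Poly_Mapping.single v 1)
      (of_nat (poly_mapping.lookup \<alpha> v) * poly_mapping.lookup h \<alpha>) \<noteq> 0}" for h :: "('a \<Rightarrow>\<^sub>0 nat) \<Rightarrow>\<^sub>0 'b"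
    by (rule finite_subset[OF _ finite_keys[of h]]) (auto simp: in_keys_iff)
  show ?thesis
    unfolding partial_def lookup_add distrib_left single_add
    by (rule Sum_any.distrib[OF fin fin])
qed

lemma partial_single:
  "partial v (Poly_Mapping.single \<alpha> c)
    = Poly_Mapping.single (\<alpha> - Poly_Mapping.single v 1) (of_nat (poly_mapping.lookup \<alpha> v) * c)"
proof -
  have "partial v (Poly_Mapping.single \<alpha> c) =
    (\<Sum>\<beta>. Poly_Mapping.single (\<alpha> - Poly_Mapping.single v 1)
      (of_nat (poly_mapping.lookup \<alpha> v) * c) when \<beta> = \<alpha>)"
    unfolding partial_def by (rule Sum_any.cong) (auto simp: lookup_single when_def)
  then show ?thesis by simp
qed

text \<open>Both sides are biadditive in \<open>f\<close> and \<open>g\<close>, so it suffices to compare them on monomials, where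
  the rule amounts to \<open>(\<alpha> + \<beta>) v = \<alpha> v + \<beta> v\<close>.\<close>

lemma partial_mult: "partial v (f * g) = f * partial v g + g * partial v f"
proof (induction f rule: polynomial_additive_induct)
  case (monomial \<alpha> c)
  show ?case
  proof (induction g rule: polynomial_additive_induct)
    case (monomial \<beta> d)
    let ?e = "Poly_Mapping.single v 1 :: 'a \<Rightarrow>\<^sub>0 nat"
    \<comment> \<open>If \<open>\<delta>\<close> does not involve \<open>v\<close>, the exponents may differ but both coefficients are zero.\<close>
    have shift: "Poly_Mapping.single (\<gamma> + (\<delta> - ?e)) (of_nat (poly_mapping.lookup \<delta> v) * k)
        = Poly_Mapping.single (\<gamma> + \<delta> - ?e) (of_nat (poly_mapping.lookup \<delta> v) * k)" for \<gamma> \<delta> and k :: 'b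
    proof (cases "poly_mapping.lookup \<delta> v = 0")
      case False
      then have "\<gamma> + (\<delta> - ?e) = \<gamma> + \<delta> - ?e"
        by (auto simp: poly_mapping_eq_iff fun_eq_iff lookup_add lookup_minus lookup_single when_def)
      then show ?thesis by simp
    qed simp
    have "Poly_Mapping.single \<alpha> c * partial v (Poly_Mapping.single \<beta> d)
        = Poly_Mapping.single (\<alpha> + \<beta> - ?e) (of_nat (poly_mapping.lookup \<beta> v) * (c * d))"
      using shift[of \<alpha> \<beta> "c * d"] by (simp add: partial_single mult_single mult_ac)
    moreover have "Poly_Mapping.single \<beta> d * partial v (Poly_Mapping.single \<alpha> c)
        = Poly_Mapping.single (\<alpha> + \<beta> - ?e) (of_nat (poly_mapping.lookup \<alpha> v) * (c * d))"
      using shift[of \<beta> \<alpha> "c * d"] by (simp add: partial_single mult_single mult_ac add.commute)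
    ultimately show ?case
      by (simp add: partial_single mult_single lookup_add algebra_simps flip: single_add)
  next
    case (add f g)
    then show ?case by (simp add: partial_add algebra_simps)
  qed
next
  case (add f g)
  then show ?case by (simp add: partial_add algebra_simps)
qed

lemma partial_indet: "partial v (indet w) = (if v = w then 1 else 0)"
  by (auto simp: indet_def partial_single lookup_single)

definition vars :: "var set" where "vars = {VX, VY, VZ, VT, VU}"

definition derivation_with_values :: "(var \<Rightarrow> poly5) \<Rightarrow> poly5 \<Rightarrow> poly5" where
  "derivation_with_values d f = (\<Sum>v\<in>vars. d v * partial v f)"

lemma complex_derivationI:
  assumes "complex_algebra scale"
    and "\<And>f g. D (f + g) = D f + D g" "\<And>k f. D (scale k f) = scale k (D f)"
    and "\<And>f g. D (f * g) = f * D g + g * D f"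
  shows "complex_derivation scale D"
proof -
  interpret complex_algebra scale by fact
  show ?thesis
    by unfold_locales (use assms in auto)
qed

lemma complex_derivation_with_values: "complex_derivation scaleP (derivation_with_values d)"
  by (rule complex_derivationI[OF complex_algebra_scaleP])
    (simp_all add: derivation_with_values_def partial_add partial_single partial_mult
      scaleP_conv_mult sum.distrib sum_distrib_left algebra_simps)

lemma derivation_with_values_indet: "derivation_with_values d (indet v) = d v"
  by (cases v) (simp_all add: derivation_with_values_def vars_def partial_indet)

lemma derivation_const_poly:
  assumes "complex_derivation scaleP D"
  shows "D (Poly_Mapping.single 0 c) = 0"
proof -
  interpret complex_derivation scaleP D by fact
  have "D (scaleP c 1) = 0"
    by (simp only: derivation_scale derivation_one scale_zero_right)
  then show ?thesis by (simp add: scaleP_conv_mult)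
qed

lemma derivation_eqI:
  assumes "complex_derivation scaleP D" "complex_derivation scaleP D'"
    and "\<And>v. D (indet v) = D' (indet v)"
  shows "D = D'"
proof
  fix f
  interpret D: complex_derivation scaleP D by fact
  interpret D': complex_derivation scaleP D' by fact
  show "D f = D' f"
  proof (induction f rule: polynomial_generator_induct)
    case (const c)
    show ?case by (simp add: assms derivation_const_poly)
  next
    case (indet v)
    show ?case using assms(3)[of v] by (simp add: indet_def)
  qed (simp_all add: D.derivation_add D'.derivation_add D.leibniz D'.leibniz)
qed

lemma locally_nilpotent_if_nil_generators:
  assumes "complex_derivation scaleP D"
    and "\<And>v. indet v \<in> complex_derivation.nil D"
  shows "locally_nilpotent D"
proof -
  interpret complex_derivation scaleP D by fact
  show ?thesis
  proof (rule locally_nilpotent_if_nil_UNIV)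
    show "f \<in> nil" for f
    proof (induction f rule: polynomial_generator_induct)
      case (const c)
      show ?case by (rule nil_constant) (simp add: assms derivation_const_poly)
    next
      case (indet v)
      show ?case using assms(2)[of v] by (simp add: indet_def)
    qed (simp_all add: nil_add nil_mult)
  qed
qed

section \<open>Descent to the coordinate ring\<close>

lemma residue_surj: "\<exists>f. residue f = q"
  by transfer (metis cancel_comm_monoid_add_class.diff_cancel dvd_0_right)

lemma residue_add: "residue (f + g) = residue f + residue g"
  and residue_mult: "residue (f * g) = residue f * residue g"
  and residue_scale: "residue (scaleP k f) = scaleY k (residue f)"
  by (transfer, simp)+

lemma residue_eq_iff: "residue f = residue g \<longleftrightarrow> Ptilde dvd f - g"
  by transfer simp

text \<open>If \<open>f - g\<close> is a multiple \<open>Ptilde * h\<close>, then \<open>E f - E g = Ptilde * E h + h * E Ptilde\<close> is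
  again one, so \<open>E\<close> respects residue classes.\<close>

lemma induced_derivation:
  assumes "complex_derivation scaleP E" and "Ptilde dvd E Ptilde"
  shows "\<exists>D. (\<forall>f. D (residue f) = residue (E f)) \<and> complex_derivation scaleY D
    \<and> (locally_nilpotent E \<longrightarrow> locally_nilpotent D)"
proof -
  interpret complex_derivation scaleP E by fact
  have well_defined: "residue (E f) = residue (E g)" if "residue f = residue g" for f g
  proof -
    have "Ptilde dvd f - g" using that by (simp only: residue_eq_iff)
    then obtain h where "f - g = Ptilde * h" by (rule dvdE)
    then have "E f - E g = Ptilde * E h + h * E Ptilde"
      by (metis derivation_diff leibniz)
    then show ?thesis using assms(2) by (simp add: residue_eq_iff)
  qed
  define D where "D q = residue (E (SOME f. residue f = q))" for q
  have D: "D (residue f) = residue (E f)" for f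
    unfolding D_def by (rule well_defined) (rule someI, rule refl)
  have "complex_derivation scaleY D"
  proof (rule complex_derivationI[OF complex_algebra_scaleY])
    fix p q k
    obtain f g where [simp]: "p = residue f" "q = residue g" by (metis residue_surj)
    show "D (p + q) = D p + D q"
      by (simp add: D derivation_add flip: residue_add)
    show "D (scaleY k p) = scaleY k (D p)"
      by (simp add: D derivation_scale flip: residue_scale)
    show "D (p * q) = p * D q + q * D p"
      by (simp add: D leibniz flip: residue_add residue_mult)
  qed
  moreover have "locally_nilpotent D" if "locally_nilpotent E"
    unfolding locally_nilpotent_def
  proof
    fix q
    obtain f where f: "q = residue f" by (metis residue_surj)
    have "(D ^^ n) (residue f) = residue ((E ^^ n) f)" for n
      by (induction n) (simp_all add: D)
    then show "\<exists>n\<ge>1. (D ^^ n) q = 0"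
      using that unfolding locally_nilpotent_def f by (metis dvd_0_right residue_eq_0_iff)
  qed
  ultimately show ?thesis using D by blast
qed

section \<open>The derivation E\<close>

lemma ex1_is_E: "\<exists>!E. is_E E"
proof (rule ex_ex1I)
  let ?d = "\<lambda>v. case v of VX \<Rightarrow> 3 * pT ^ 2 * pm | VY \<Rightarrow> 0 | VZ \<Rightarrow> - 3 * pa * pY * pT ^ 2
    | VT \<Rightarrow> pa * pc | VU \<Rightarrow> scaleP (- 3 / 2) (pY ^ 2 * pT ^ 2)"
  have "is_E (derivation_with_values ?d)"
    by (simp add: is_E_def complex_derivation_with_values derivation_with_values_indet)
  then show "\<exists>E. is_E E" by blast
next
  fix E E' assume "is_E E" "is_E E'"
  moreover from this have "E (indet v) = E' (indet v)" for v
    by (cases v) (simp_all add: is_E_def)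
  ultimately show "E = E'"
    unfolding is_E_def by (intro derivation_eqI) simp_all
qed

locale derivation_E =
  fixes E :: "poly5 \<Rightarrow> poly5"
  assumes is_E: "is_E E"
begin

sublocale complex_derivation scaleP E
  using is_E by (simp add: is_E_def)

lemma E_X: "E pX = 3 * pT ^ 2 * pm"
  and E_Y: "E pY = 0"
  and E_Z: "E pZ = - 3 * pa * pY * pT ^ 2"
  and E_T: "E pT = pa * pc"
  using is_E by (simp_all add: is_E_def)

text \<open>In \<open>a\<close>, \<open>c\<close>, \<open>m\<close> and \<open>Ptilde\<close> the indeterminate \<open>u\<close> always carries a factor 2. Doubling
  \<open>E u\<close> removes the denominator, and the remaining computations use integer coefficients only.\<close>

lemma two_E_U: "2 * E pU = - 3 * pY ^ 2 * pT ^ 2"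
proof -
  have "2 * scaleP (- 3 / 2) f = - 3 * f" for f
  proof -
    have "2 * scaleP (- 3 / 2) f = scaleP (- 3 / 2) f + scaleP (- 3 / 2) f"
      by (rule mult_2)
    also have "\<dots> = scaleP (- 3) f"
      unfolding scaleP_add_left [symmetric] by simp
    also have "\<dots> = - 3 * f"
      by (simp add: scaleP_conv_mult single_uminus single_numeral)
    finally show ?thesis .
  qed
  then show ?thesis using is_E by (simp add: is_E_def mult.assoc)
qed

lemma E_pa: "E pa = 0"
proof -
  have "E pa = pY * E pX + 2 * pU * E pZ + pZ * (2 * E pU)"
    by (simp add: pa_def derivation_simps E_Y algebra_simps)
  also have "\<dots> = 3 * pT ^ 2 * pY * (pm - (pZ * pY + 2 * pa * pU))"
    unfolding E_X E_Z two_E_U by (simp add: algebra_simps power2_eq_square)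
  finally show ?thesis by (simp add: pm_def)
qed

lemma E_pc: "E pc = 0"
proof -
  have "E pc = pY * E pZ - pa * (2 * E pU)"
    by (simp add: pc_def derivation_simps E_Y E_pa algebra_simps)
  then show ?thesis
    unfolding E_Z two_E_U by (simp add: algebra_simps power2_eq_square)
qed

lemma E_pm: "E pm = - 6 * pa * pY ^ 2 * pT ^ 2"
proof -
  have "E pm = pY * E pZ + pa * (2 * E pU)"
    by (simp add: pm_def derivation_simps E_Y E_pa algebra_simps)
  then show ?thesis
    unfolding E_Z two_E_U by (simp add: algebra_simps power2_eq_square)
qed

lemma E_Ptilde: "E Ptilde = 0"
proof -
  have "E Ptilde = (1 + 2 * pX * pY + 2 * pZ * pU) * E pX + (2 * pX * pU + 2 * pZ) * E pZ
      + pX * pZ * (2 * E pU) + 3 * pT ^ 2 * E pT"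
    by (simp add: Ptilde_def derivation_simps E_Y algebra_simps power2_eq_square)
  \<comment> \<open>The partial derivative by \<open>x\<close> is rewritten with \<open>a\<close>, so that \<open>3t\<^sup>2\<close> times \<open>a\<close> or \<open>xy\<close>
      can be collected; both cofactors then vanish by the definitions of \<open>m\<close> and \<open>c\<close>.\<close>
  also have "1 + 2 * pX * pY + 2 * pZ * pU = pa + pX * pY"
    by (simp add: pa_def)
  also have "(pa + pX * pY) * E pX + (2 * pX * pU + 2 * pZ) * E pZ
      + pX * pZ * (2 * E pU) + 3 * pT ^ 2 * E pT
    = 3 * pT ^ 2 * (pa * (pm + pc - 2 * pZ * pY) + pX * pY * (pm - (pZ * pY + 2 * pa * pU)))"
    unfolding E_X E_Z E_T two_E_U by (simp add: algebra_simps power2_eq_square)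
  also have "\<dots> = 0"
    by (simp add: pm_def pc_def)
  finally show ?thesis .
qed

text \<open>The order matters: \<open>t\<close> comes before \<open>z\<close>, \<open>u\<close> and \<open>m\<close>, and \<open>m\<close> before \<open>x\<close>, so that the
  derivative of each element is a polynomial in elements already known to be nilpotent.\<close>

lemma nil_generator: "indet v \<in> nil"
proof -
  have numeral: "numeral k \<in> nil" for k
    by (auto intro!: nil_constant simp: derivation_simps)
  have y: "pY \<in> nil" and a: "pa \<in> nil" and c: "pc \<in> nil"
    by (auto intro: nil_constant simp: E_Y E_pa E_pc)
  have t: "pT \<in> nil"
    by (rule nil_if_derivative_nil) (simp add: E_T nil_mult a c)
  have z: "pZ \<in> nil"
    by (rule nil_if_derivative_nil) (simp add: E_Z nil_minus nil_mult nil_power numeral a y t)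
  have m: "pm \<in> nil"
    by (rule nil_if_derivative_nil) (simp add: E_pm nil_minus nil_mult nil_power numeral a y t)
  have x: "pX \<in> nil"
    by (rule nil_if_derivative_nil) (simp add: E_X nil_mult nil_power numeral m t)
  have u: "pU \<in> nil"
  proof (rule nil_if_derivative_nil)
    have "Poly_Mapping.single 0 (- 3 / 2) \<in> nil"
      by (intro nil_constant derivation_const_poly complex_derivation_axioms)
    then show "E pU \<in> nil"
      using is_E by (simp add: is_E_def scaleP_conv_mult nil_mult nil_power y t)
  qed
  show ?thesis by (cases v) (simp_all add: x y z t u)
qed

end

theorem proposition1p2:
  shows "(\<exists>!E. is_E E) \<and>
    (\<forall>E. is_E E \<longrightarrow>
      E pa = 0 \<and> E pc = 0 \<and> E pm = - 6 * pa * pY ^ 2 * pT ^ 2 \<and>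
      locally_nilpotent E \<and> E Ptilde = 0 \<and>
      (\<exists>D. (\<forall>f. D (residue f) = residue (E f)) \<and>
           complex_derivation scaleY D \<and> locally_nilpotent D))"
proof (intro conjI allI impI)
  show "\<exists>!E. is_E E" by (rule ex1_is_E)
next
  fix E assume "is_E E"
  then interpret derivation_E E by unfold_locales
  show "E pa = 0" "E pc = 0" "E pm = - 6 * pa * pY ^ 2 * pT ^ 2" "E Ptilde = 0"
    by (rule E_pa E_pc E_pm E_Ptilde)+
  show nilpotent: "locally_nilpotent E"
    by (rule locally_nilpotent_if_nil_generators[OF complex_derivation_axioms nil_generator])
  show "\<exists>D. (\<forall>f. D (residue f) = residue (E f)) \<and> complex_derivation scaleY D
      \<and> locally_nilpotent D"
    using induced_derivation[OF complex_derivation_axioms] nilpotent by (auto simp: E_Ptilde)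
qed

end
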